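(* The following are equivalent: \begin{enumerate} \item The nonlinear map $\alpha:\hat{H}\rightarrow\mathbb{R}^m$, $(\alpha(x))_k=|\langle x,f_k\rangle|^2$, is injective. \item There is a constant $a_0>0$ so that for every $u,v\in H$ $$\sum_{k=1}^m |\langle F_k,\llbracket u,v\rrbracket\rangle|^2 \geq a_0 \|\llbracket u,v\rrbracket\|_1^2 .$$ Explicitly, this means that for every $u,v\in H$ $$\sum_{k=1}^m \left( \mathrm{real}(\langle u,f_k\rangle\langle f_k,v\rangle) \right)^2 \geq a_0 \left[ \|u\|^2 \|v\|^2 - (\mathrm{imag}(\langle u,v\rangle))^2\right] .$$ \item For any $\xi\in H_{\mathbb{R}}$, $\xi\neq 0$, $\mathrm{rank}(R(\xi)) = 2n-1$. \item There is $a_0>0$ so that for all $\xi\in H_{\mathbb{R}}$, $\xi\neq 0$, $$R(\xi) \geq a_0 \|\xi\|^2 P_{J\xi}^{\perp},$$ where the inequality holds in the sense of quadratic forms in $H_{\mathbb{R}}$, and $P_{J\xi}^{\perp} = 1 - \frac{1}{\|\xi\|^2 }J\xi\xi^*J^*$ is the orthogonal projection in $H_{\mathbb{R}}$ onto the orthogonal complement of $J\xi$ in $H_{\mathbb{R}}$. \end{enumerate}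
   Context: $H$ is a complex Hilbert space of finite dimension $n$, with scalar product $\langle\cdot,\cdot\rangle$ linear in the first and antilinear in the second argument, and with a conjugation $c:H\to H$ (antilinear, $c\circ c=\mathrm{id}$, $\langle c(x),c(y)\rangle=\langle y,x\rangle$). $\{f_1,\dots,f_m\}$ is a frame (spanning set) for $H$. $\hat H=H/\sim$, where $x\sim y$ iff $y=zx$ for some $z\in\mathbb{C}$ with $|z|=1$. For $u,v\in H$, $uv^*$ denotes the operator $x\mapsto\langle x,v\rangle u$, and $\llbracket u,v\rrbracket=\frac12(uv^*+vu^* )$. $F_k=f_kf_k^*$. On $B(H)$ (linear operators on $H$) $\langle T,S\rangle=\mathrm{tr}(TS^* )$, and $\|T\|_1$ is the nuclear norm (sum of singular values). Realification: $\mathbf{j}:H\to H\times H$, $\mathbf{j}(v)=\left(\frac12(v+c(v)),\frac1{2i}(v-c(v))\right)$; $H_{\mathbb{R}}=\mathbf{j}(H)$, a real vector space of dimension $2n$ with the real inner product $\langle \mathbf{j}(v),\mathbf{j}(w)\rangle=\mathrm{real}\langle v,w\rangle$. $J:H_{\mathbb{R}}\to H_{\mathbb{R}}$ is $J(v,w)=(-w,v)$, so $J\mathbf{j}(v)=\mathbf{j}(iv)$. Adjoints in $H_{\mathbb{R}}$ are with respect to this real inner product, and for $\xi\in H_{\mathbb{R}}$, $\xi\xi^*$ is the operator $\eta\mapsto\langle\eta,\xi\rangle\xi$. Put $\varphi_k=\mathbf{j}(f_k)$, $\Phi_k=\varphi_k\varphi_k^*+J\varphi_k\varphi_k^*J^*$,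 and for $\xi\in H_{\mathbb{R}}$ $$R(\xi)=\sum_{k=1}^m\Phi_k\xi\xi^*\Phi_k .$$ *)

theory Defs
  imports "HOL-Analysis.Analysis"
begin

(* Complex inner product spaces, with the inner product linear in the first argument.
   The underlying real structure is tied to the complex one: scaleR is the restriction
   of scaleC, and inner is the real part of cinner.  Hence norm x is the square root of
   cinner x x, and positive definiteness comes from the class real_inner. *)
class complex_inner = real_inner +
  fixes scaleC :: "complex \<Rightarrow> 'a \<Rightarrow> 'a" (infixr "*\<^sub>C" 75)
    and cinner :: "'a \<Rightarrow> 'a \<Rightarrow> complex"
  assumes scaleC_add_right: "a *\<^sub>C (x + y) = a *\<^sub>C x + a *\<^sub>C y"
    and scaleC_add_left: "(a + b) *\<^sub>C x = a *\<^sub>C x + b *\<^sub>C x"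
    and scaleC_scaleC: "a *\<^sub>C (b *\<^sub>C x) = (a * b) *\<^sub>C x"
    and scaleC_of_real: "of_real r *\<^sub>C x = r *\<^sub>R x"
    and cinner_add_left: "cinner (x + y) z = cinner x z + cinner y z"
    and cinner_scaleC_left: "cinner (a *\<^sub>C x) y = a * cinner x y"
    and cinner_commute: "cinner x y = cnj (cinner y x)"
    and Re_cinner: "Re (cinner x y) = inner x y"

global_interpretation complex_vector:
  vector_space "scaleC :: complex \<Rightarrow> 'a \<Rightarrow> 'a :: complex_inner"
  defines cspan = complex_vector.span
    and cdim = complex_vector.dim
proof
  show "1 *\<^sub>C x = x" for x :: 'a
    using scaleC_of_real[of 1 x] by simp
qed (simp_all add: scaleC_add_right scaleC_add_left scaleC_scaleC)

lemma cinner_add_right: "cinner x (y + z) = cinner x y + cinner x z"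
  by (metis cinner_add_left cinner_commute complex_cnj_add)

lemma cinner_scaleC_right: "cinner x (a *\<^sub>C y) = cnj a * cinner x y"
  by (metis cinner_scaleC_left cinner_commute complex_cnj_mult)

lemma cinner_diff_left: "cinner (x - y) z = cinner x z - cinner y z"
  by (metis cinner_add_left add_diff_cancel diff_add_cancel)

lemma cinner_diff_right: "cinner x (y - z) = cinner x y - cinner x z"
  by (metis cinner_add_right add_diff_cancel diff_add_cancel)

lemma Re_cinner_self: "Re (cinner x x) = (norm x)\<^sup>2"
  by (simp add: Re_cinner power2_norm_eq_inner)

definition conjugation :: "('a::complex_inner \<Rightarrow> 'a) \<Rightarrow> bool" where
  "conjugation c \<longleftrightarrow>
     (\<forall>x y. c (x + y) = c x + c y) \<and> (\<forall>a x. c (a *\<^sub>C x) = cnj a *\<^sub>C c x) \<and>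
     (\<forall>x. c (c x) = x) \<and> (\<forall>x y. cinner (c x) (c y) = cinner y x)"


definition phase_rel :: "('a::complex_inner \<times> 'a) set" where
  "phase_rel = {(x, y). \<exists>z. cmod z = 1 \<and> y = z *\<^sub>C x}"

definition Hhat :: "'a::complex_inner set set" where
  "Hhat = UNIV // phase_rel"

(* The common value on an equivalence class, see alpha_class.  Elements of \<real>^m are
   functions on {1..m}, extended by undefined. *)
definition alpha :: "(nat \<Rightarrow> 'a::complex_inner) \<Rightarrow> nat \<Rightarrow> 'a set \<Rightarrow> nat \<Rightarrow> real" where
  "alpha f m X = the_elem ((\<lambda>x. \<lambda>k\<in>{1..m}. (cmod (cinner x (f k)))\<^sup>2) ` X)"

lemma equiv_phase_rel: "equiv UNIV phase_rel"
proof (rule equivI)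
  show "refl phase_rel"
    by (auto simp: refl_on_def phase_rel_def intro: exI[of _ 1])
  show "sym phase_rel"
  proof (rule symI)
    fix x y assume "(x, y) \<in> phase_rel"
    then obtain z where z: "cmod z = 1" "y = z *\<^sub>C x"
      by (auto simp: phase_rel_def)
    then have "z \<noteq> 0" by auto
    with z have "cmod (inverse z) = 1" "x = inverse z *\<^sub>C y"
      by (simp_all add: norm_inverse)
    then show "(y, x) \<in> phase_rel"
      unfolding phase_rel_def by blast
  qed
  show "trans phase_rel"
  proof (rule transI)
    fix x y w assume "(x, y) \<in> phase_rel" "(y, w) \<in> phase_rel"
    then obtain a b where "cmod a = 1" "y = a *\<^sub>C x" "cmod b = 1" "w = b *\<^sub>C y"
      by (auto simp: phase_rel_def)
    then have "cmod (b * a) = 1" "w = (b * a) *\<^sub>C x"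
      by (auto simp: norm_mult)
    then show "(x, w) \<in> phase_rel"
      unfolding phase_rel_def by blast
  qed
qed auto

lemma alpha_class:
  "alpha f m (phase_rel `` {x}) = (\<lambda>k\<in>{1..m}. (cmod (cinner x (f k)))\<^sup>2)"
proof -
  have "(\<lambda>x. \<lambda>k\<in>{1..m}. (cmod (cinner x (f k)))\<^sup>2) ` (phase_rel `` {x}) =
    {\<lambda>k\<in>{1..m}. (cmod (cinner x (f k)))\<^sup>2}" (is "?g ` _ = _")
  proof -
    have "?g y = ?g x" if "y \<in> phase_rel `` {x}" for y
      using that by (auto simp: phase_rel_def cinner_scaleC_left norm_mult)
    moreover have "x \<in> phase_rel `` {x}"
      using equiv_phase_rel equiv_class_self by fastforce
    ultimately show ?thesis by blast
  qed
  then show ?thesis by (simp add: alpha_def)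
qed


definition couter :: "'a::complex_inner \<Rightarrow> 'a \<Rightarrow> 'a \<Rightarrow> 'a" where
  "couter u v = (\<lambda>x. cinner x v *\<^sub>C u)"

definition sym_couter :: "'a::complex_inner \<Rightarrow> 'a \<Rightarrow> 'a \<Rightarrow> 'a" where
  "sym_couter u v = (\<lambda>x. (1/2) *\<^sub>C (couter u v x + couter v u x))"

definition cadjoint :: "('a::complex_inner \<Rightarrow> 'a) \<Rightarrow> 'a \<Rightarrow> 'a" where
  "cadjoint T = (SOME S. \<forall>x y. cinner (T x) y = cinner x (S y))"

definition orthonormal_basis :: "'a::complex_inner set \<Rightarrow> bool" where
  "orthonormal_basis B \<longleftrightarrow>
     finite B \<and> (\<forall>x\<in>B. \<forall>y\<in>B. cinner x y = (if x = y then 1 else 0)) \<and> cspan B = UNIV"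

(* The trace of a linear operator does not depend on the chosen orthonormal basis. *)
definition ctrace :: "('a::complex_inner \<Rightarrow> 'a) \<Rightarrow> complex" where
  "ctrace T = (\<Sum>e\<in>(SOME B. orthonormal_basis B). cinner (T e) e)"

definition op_inner :: "('a::complex_inner \<Rightarrow> 'a) \<Rightarrow> ('a \<Rightarrow> 'a) \<Rightarrow> complex" where
  "op_inner T S = ctrace (T \<circ> cadjoint S)"

(* The singular values of T are the nonnegative s such that s^2 is an eigenvalue of T*T,
   counted with the dimension of the eigenspace. *)
definition singular_values :: "('a::complex_inner \<Rightarrow> 'a) \<Rightarrow> real set" where
  "singular_values T =
     {s. 0 \<le> s \<and> (\<exists>x. x \<noteq> 0 \<and> cadjoint T (T x) = complex_of_real (s\<^sup>2) *\<^sub>C x)}"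

definition nuclear_norm :: "('a::complex_inner \<Rightarrow> 'a) \<Rightarrow> real" where
  "nuclear_norm T =
     (\<Sum>s\<in>singular_values T.
        real (cdim {x. cadjoint T (T x) = complex_of_real (s\<^sup>2) *\<^sub>C x}) * s)"


definition jmap :: "('a::complex_inner \<Rightarrow> 'a) \<Rightarrow> 'a \<Rightarrow> 'a \<times> 'a" where
  "jmap c v = ((1/2) *\<^sub>C (v + c v), (1 / (2 * \<i>)) *\<^sub>C (v - c v))"

(* Vector space operations, inner and norm on HR c are those of the real inner product
   space 'a \<times> 'a, see subspace_HR and inner_jmap. *)
definition HR :: "('a::complex_inner \<Rightarrow> 'a) \<Rightarrow> ('a \<times> 'a) set" where
  "HR c = range (jmap c)"

definition Jmap :: "'a::complex_inner \<times> 'a \<Rightarrow> 'a \<times> 'a" where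
  "Jmap = (\<lambda>(v, w). (- w, v))"

(* Adjoint of an operator on the finite-dimensional real subspace V. *)
definition adjoint_on :: "'b::real_inner set \<Rightarrow> ('b \<Rightarrow> 'b) \<Rightarrow> 'b \<Rightarrow> 'b" where
  "adjoint_on V T y = (THE z. z \<in> V \<and> (\<forall>x\<in>V. T x \<bullet> y = x \<bullet> z))"

definition router :: "'b::real_inner \<Rightarrow> 'b \<Rightarrow> 'b" where
  "router \<xi> = (\<lambda>\<eta>. (\<eta> \<bullet> \<xi>) *\<^sub>R \<xi>)"

definition Jouter :: "('a::complex_inner \<Rightarrow> 'a) \<Rightarrow> 'a \<times> 'a \<Rightarrow> 'a \<times> 'a \<Rightarrow> 'a \<times> 'a" where
  "Jouter c \<xi> = Jmap \<circ> router \<xi> \<circ> adjoint_on (HR c) Jmap"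

definition Phi :: "('a::complex_inner \<Rightarrow> 'a) \<Rightarrow> (nat \<Rightarrow> 'a) \<Rightarrow> nat \<Rightarrow> 'a \<times> 'a \<Rightarrow> 'a \<times> 'a" where
  "Phi c f k = (\<lambda>\<eta>. router (jmap c (f k)) \<eta> + Jouter c (jmap c (f k)) \<eta>)"

definition Rop ::
  "('a::complex_inner \<Rightarrow> 'a) \<Rightarrow> (nat \<Rightarrow> 'a) \<Rightarrow> nat \<Rightarrow> 'a \<times> 'a \<Rightarrow> 'a \<times> 'a \<Rightarrow> 'a \<times> 'a" where
  "Rop c f m \<xi> = (\<lambda>\<eta>. \<Sum>k=1..m. Phi c f k (router \<xi> (Phi c f k \<eta>)))"

definition Pperp ::
  "('a::complex_inner \<Rightarrow> 'a) \<Rightarrow> 'a \<times> 'a \<Rightarrow> 'a \<times> 'a \<Rightarrow> 'a \<times> 'a" where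
  "Pperp c \<xi> = (\<lambda>\<eta>. \<eta> - (1 / (norm \<xi>)\<^sup>2) *\<^sub>R Jouter c \<xi> \<eta>)"

lemma subspace_HR:
  assumes "conjugation c" shows "subspace (HR c)"
proof -
  have add: "jmap c (x + y) = jmap c x + jmap c y" for x y
    using assms
    by (simp add: conjugation_def jmap_def complex_vector.scale_right_distrib
        complex_vector.scale_right_diff_distrib)
  have c: "c (r *\<^sub>R x) = r *\<^sub>R c x" for r x
    using assms by (metis conjugation_def scaleC_of_real complex_cnj_complex_of_real)
  have comm: "a *\<^sub>C r *\<^sub>R y = r *\<^sub>R a *\<^sub>C y" for a r and y :: 'a
    by (metis scaleC_of_real complex_vector.scale_left_commute)
  have scale: "jmap c (r *\<^sub>R x) = r *\<^sub>R jmap c x" for r x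
    by (simp add: jmap_def c comm flip: scaleR_add_right scaleR_diff_right)
  have "linear (jmap c)"
    by (rule linearI) (fact add scale)+
  then show ?thesis
    unfolding HR_def by (simp add: linear_subspace_image)
qed

lemma inner_jmap:
  assumes "conjugation c"
  shows "jmap c v \<bullet> jmap c w = Re (cinner v w)"
proof -
  have "cinner (c v) (c w) = cnj (cinner v w)"
    using assms by (metis conjugation_def cinner_commute)
  then show ?thesis
    by (simp add: jmap_def inner_prod_def cinner_scaleC_left cinner_scaleC_right
        cinner_add_left cinner_add_right cinner_diff_left cinner_diff_right
        field_simps flip: Re_cinner)
qed

lemma Jmap_jmap:
  assumes "conjugation c"
  shows "Jmap (jmap c v) = jmap c (\<i> *\<^sub>C v)"
proof -
  have "c (\<i> *\<^sub>C v) = - (\<i> *\<^sub>C c v)"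
    using assms by (simp add: conjugation_def)
  moreover have "1 / (2 * \<i>) = - (\<i> / 2)"
    by (simp add: field_simps)
  ultimately show ?thesis
    by (simp add: Jmap_def jmap_def complex_vector.scale_right_distrib
        complex_vector.scale_right_diff_distrib)
qed

end

theory Submission
  imports Defs
begin

text \<open>Everything is a statement about two functions of a pair of vectors, the quadratic form of the frame,
\<open>frame_form f m u v\<close>, which is the sum of the squares of the real parts of
\<open>\<langle>u, f\<^sub>k\<rangle>\<langle>f\<^sub>k, v\<rangle>\<close>, and
\<open>phase_gap u v = \<parallel>u\<parallel>\<^sup>2 \<parallel>v\<parallel>\<^sup>2 - (Im \<langle>u, v\<rangle>)\<^sup>2\<close>. In the real inner product
\<open>Re \<langle>u, v\<rangle>\<close> the number \<open>- Im \<langle>u, v\<rangle>\<close> is the product of \<open>v\<close> with \<open>\<i>u\<close>, so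
\<open>phase_gap u v\<close> is \<open>\<parallel>u\<parallel>\<^sup>2\<close> times the squared distance of \<open>v\<close> from the real line through \<open>\<i>u\<close>,
the tangent direction of the phase orbit of \<open>u\<close>. Neither function changes when a real multiple of
\<open>\<i>u\<close> is added to \<open>v\<close>.

Injectivity (\<open>inj_alpha_iff\<close>): with \<open>u = x + y\<close> and \<open>v = x - y\<close>, the difference
\<open>\<bar>\<langle>x, f\<^sub>k\<rangle>\<bar>\<^sup>2 - \<bar>\<langle>y, f\<^sub>k\<rangle>\<bar>\<^sup>2\<close> is the real part of \<open>\<langle>u, f\<^sub>k\<rangle>\<langle>f\<^sub>k, v\<rangle>\<close>, and \<open>x\<close>, \<open>y\<close> differ by a phase exactly
if \<open>phase_gap u v = 0\<close>. Hence the map is injective iff \<open>frame_form\<close> vanishes only where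
\<open>phase_gap\<close> does.

Uniform constant (\<open>frame_form_lower_bound\<close>): removing the component along \<open>\<i>u\<close> and scaling reduces
the estimate to unit vectors \<open>u\<close>, \<open>v\<close> with \<open>v\<close> orthogonal to \<open>\<i>u\<close> in the real sense. These form a compact
set, on which \<open>phase_gap = 1\<close> and \<open>frame_form\<close> is continuous and positive.

Nuclear norm (\<open>nuclear_norm_sym_couter\<close>): \<open>\<lbrakk>u, v\<rbrakk>\<close> is unchanged if a multiple of \<open>\<i>u\<close> is removed
from \<open>v\<close> and if \<open>u\<close>, \<open>v\<close> are rescaled by inverse real factors. This reduces to \<open>\<parallel>u\<parallel> = \<parallel>v\<parallel>\<close> and
\<open>\<langle>u, v\<rangle>\<close> real, where \<open>u + v\<close> and \<open>u - v\<close> are orthogonal and polarisation diagonalises \<open>\<lbrakk>u, v\<rbrakk>\<close>.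

Realification (\<open>Rop_quadratic_form\<close>, \<open>Pperp_quadratic_form\<close>, \<open>dim_Rop_image\<close>): \<open>\<Phi>\<^sub>k\<close> is the
realification of \<open>f\<^sub>kf\<^sub>k\<^sup>*\<close>, so for \<open>\<xi> = j(u)\<close> the quadratic form of \<open>R(\<xi>)\<close> at \<open>j(v)\<close> is \<open>frame_form\<close>
and that of \<open>\<parallel>\<xi>\<parallel>\<^sup>2 P\<close> is \<open>phase_gap\<close>; the operator inequality is the uniform estimate. Pulled back
along \<open>j\<close>, the kernel of \<open>R(\<xi>)\<close> is the set of zeros \<open>v\<close> of \<open>frame_form f m u\<close>. For \<open>u \<noteq> 0\<close> it contains the
nonzero vector \<open>\<i>u\<close>, so by the rank-nullity theorem the rank is \<open>2n - 1\<close> iff that zero set is no larger than the real line through \<open>\<i>u\<close>.\<close>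

section \<open>Complex inner products\<close>

lemma cinner_zero_left [simp]: "cinner 0 y = 0"
  using cinner_diff_left[of 0 0 y] by simp

lemma cinner_zero_right [simp]: "cinner x 0 = 0"
  using cinner_diff_right[of x 0 0] by simp

lemma cinner_sum_left: "cinner (sum g A) y = (\<Sum>i\<in>A. cinner (g i) y)"
  by (induction A rule: infinite_finite_induct) (simp_all add: cinner_add_left)

lemma cinner_scaleR_left: "cinner (r *\<^sub>R x) y = of_real r * cinner x y"
  by (metis cinner_scaleC_left scaleC_of_real)

lemma cinner_scaleR_right: "cinner x (r *\<^sub>R y) = of_real r * cinner x y"
  by (metis cinner_scaleC_right scaleC_of_real complex_cnj_complex_of_real)

lemma cinner_self: "cinner x x = of_real ((norm x)\<^sup>2)"
proof (rule complex_eqI)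
  have "cinner x x = cnj (cinner x x)"
    by (rule cinner_commute)
  then show "Im (cinner x x) = Im (of_real ((norm x)\<^sup>2))"
    by (simp add: complex_eq_iff)
qed (simp add: Re_cinner_self)

lemma cinner_cancel_right: "(\<And>x. cinner x y = cinner x z) \<Longrightarrow> y = z"
  using cinner_self[of "y - z"] by (simp add: cinner_diff_right)

lemma norm_scaleC: "norm (a *\<^sub>C x) = cmod a * norm x"
proof -
  have "cinner (a *\<^sub>C x) (a *\<^sub>C x) = (a * cnj a) * cinner x x"
    by (simp add: cinner_scaleC_left cinner_scaleC_right)
  also have "\<dots> = of_real ((cmod a * norm x)\<^sup>2)"
    by (simp only: cinner_self complex_norm_square[symmetric] power_mult_distrib of_real_mult)
  finally have "of_real ((norm (a *\<^sub>C x))\<^sup>2) = (of_real ((cmod a * norm x)\<^sup>2) :: complex)"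
    by (simp only: cinner_self)
  then show ?thesis
    by (metis of_real_eq_iff mult_nonneg_nonneg norm_ge_zero power2_eq_iff_nonneg)
qed

lemma scaleC_scaleR_commute: "a *\<^sub>C r *\<^sub>R x = r *\<^sub>R a *\<^sub>C x"
  by (metis scaleC_of_real complex_vector.scale_left_commute)

lemma Re_scaleC_i: "Re (cinner (\<i> *\<^sub>C u) v) = - Im (cinner u v)"
  by (simp add: cinner_scaleC_left)

text \<open>The real and the imaginary part of \<open>\<langle>x, y\<rangle>\<close> are real inner products, of \<open>y\<close> with \<open>x\<close> and with
\<open>-\<i>x\<close>.\<close>
lemma continuous_on_cinner [continuous_intros]:
  fixes g h :: "'b::topological_space \<Rightarrow> 'a::complex_inner"
  assumes "continuous_on S g" "continuous_on S h"
  shows "continuous_on S (\<lambda>x. cinner (g x) (h x))"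
proof -
  have "bounded_linear (\<lambda>x. \<i> *\<^sub>C x :: 'a)"
    by (rule bounded_linear_intro[of _ 1])
      (simp_all add: complex_vector.scale_right_distrib scaleC_scaleR_commute norm_scaleC)
  then have ig: "continuous_on S (\<lambda>x. \<i> *\<^sub>C g x)"
    using assms(1) by (rule bounded_linear.continuous_on)
  have "cinner x y = Complex (x \<bullet> y) (- ((\<i> *\<^sub>C x) \<bullet> y))" for x y :: 'a
    using Re_scaleC_i[of x y] by (simp add: complex_eq_iff Re_cinner)
  then show ?thesis
    using assms ig by (simp add: Complex_eq) (intro continuous_intros)
qed

section \<open>Orthonormal bases\<close>

definition orthonormal :: "'a::complex_inner set \<Rightarrow> bool" where
  "orthonormal B \<longleftrightarrow> finite B \<and> (\<forall>x\<in>B. \<forall>y\<in>B. cinner x y = (if x = y then 1 else 0))"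

lemma orthonormal_sum_cinner:
  assumes "orthonormal B" "e \<in> B"
  shows "cinner (\<Sum>b\<in>B. g b *\<^sub>C b) e = g e"
proof -
  have "cinner (\<Sum>b\<in>B. g b *\<^sub>C b) e = (\<Sum>b\<in>B. if b = e then g b else 0)"
    using assms unfolding cinner_sum_left
    by (intro sum.cong) (auto simp: orthonormal_def cinner_scaleC_left)
  with assms show ?thesis
    by (simp add: orthonormal_def)
qed

lemma orthonormal_independent:
  assumes "orthonormal B"
  shows "\<not> complex_vector.dependent B"
proof (rule complex_vector.independent_if_scalars_zero)
  show "finite B" using assms by (simp add: orthonormal_def)
  fix g x assume "(\<Sum>b\<in>B. g b *\<^sub>C b) = 0" "x \<in> B"
  then show "g x = 0" using orthonormal_sum_cinner[OF assms, of x g] by simp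
qed

text \<open>Gram-Schmidt: each vector of \<open>S\<close> in turn contributes its normalised residual, if that is nonzero.\<close>
lemma orthonormal_extend:
  assumes "finite S" "orthonormal A"
  shows "\<exists>B. A \<subseteq> B \<and> orthonormal B \<and> S \<subseteq> cspan B"
  using assms(1)
proof induction
  case empty
  then show ?case using assms(2) by blast
next
  case (insert x S)
  then obtain B where B: "A \<subseteq> B" "orthonormal B" "S \<subseteq> cspan B" by blast
  define p where "p = (\<Sum>e\<in>B. cinner x e *\<^sub>C e)"
  define r where "r = x - p"
  have p: "p \<in> cspan B"
    unfolding p_def by (intro complex_vector.span_sum complex_vector.span_scale complex_vector.span_base)
  have r: "cinner r e = 0" if "e \<in> B" for e
    using orthonormal_sum_cinner[OF B(2) that, of "cinner x"]
    by (simp add: r_def p_def cinner_diff_left)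
  show ?case
  proof (cases "r = 0")
    case True
    with B p show ?thesis by (auto simp: r_def)
  next
    case False
    define q where "q = sgn r"
    have q0: "cinner q e = 0" "cinner e q = 0" if "e \<in> B" for e
      using r[OF that] cinner_commute[of e r]
      by (simp_all add: q_def sgn_div_norm cinner_scaleR_left cinner_scaleR_right)
    have q1: "cinner q q = 1"
      using False by (simp add: cinner_self q_def norm_sgn)
    have ortho: "orthonormal (insert q B)"
      using B(2) q0 q1 unfolding orthonormal_def by (metis finite_insert insert_iff zero_neq_one)
    have "x = norm r *\<^sub>R q + p"
      using False by (simp add: q_def sgn_div_norm r_def)
    moreover have "p \<in> cspan (insert q B)"
      using p complex_vector.span_mono[of B "insert q B"] by blast
    ultimately have "x \<in> cspan (insert q B)"
      by (metis scaleC_of_real complex_vector.span_add complex_vector.span_scale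
          complex_vector.span_base insertI1)
    moreover have "S \<subseteq> cspan (insert q B)"
      using B(3) complex_vector.span_mono[of B "insert q B"] by blast
    ultimately show ?thesis
      using B(1) ortho by (intro exI[of _ "insert q B"]) auto
  qed
qed

lemma orthonormal_basis_extend:
  assumes "finite S" "cspan S = (UNIV :: 'a::complex_inner set)" "orthonormal A"
  shows "\<exists>B. A \<subseteq> B \<and> orthonormal_basis (B :: 'a set)"
proof -
  obtain B where B: "A \<subseteq> B" "orthonormal B" "S \<subseteq> cspan B"
    using orthonormal_extend[OF assms(1,3)] by blast
  have "cspan S \<subseteq> cspan B"
    using B(3) by (simp add: complex_vector.span_minimal)
  with assms(2) B show ?thesis
    by (auto simp: orthonormal_basis_def orthonormal_def)
qed

text \<open>The residual is orthogonal to the basis, hence to its span, hence to itself.\<close>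
lemma orthonormal_basis_expand:
  assumes "orthonormal_basis B"
  shows "x = (\<Sum>e\<in>B. cinner x e *\<^sub>C e)"
proof -
  define r where "r = x - (\<Sum>e\<in>B. cinner x e *\<^sub>C e)"
  have B: "orthonormal B" using assms by (simp add: orthonormal_basis_def orthonormal_def)
  have "B \<subseteq> {y. cinner r y = 0}"
    using orthonormal_sum_cinner[OF B, of _ "cinner x"] by (auto simp: r_def cinner_diff_left)
  then have "cspan B \<subseteq> {y. cinner r y = 0}"
    by (rule complex_vector.span_minimal)
      (auto simp: complex_vector.subspace_def cinner_add_right cinner_scaleC_right)
  then have "cinner r r = 0"
    using assms by (auto simp: orthonormal_basis_def)
  then show ?thesis by (simp add: cinner_self r_def)
qed

lemma parseval:
  assumes "orthonormal_basis B"
  shows "(\<Sum>e\<in>B. cinner x e * cinner e y) = cinner x y"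
proof -
  have "cinner x y = cinner (\<Sum>e\<in>B. cinner x e *\<^sub>C e) y"
    using orthonormal_basis_expand[OF assms, of x] by simp
  then show ?thesis by (simp add: cinner_sum_left cinner_scaleC_left)
qed

lemma parseval_norm:
  assumes "orthonormal_basis B"
  shows "(\<Sum>e\<in>B. (cmod (cinner e x))\<^sup>2) = (norm x)\<^sup>2"
proof -
  have "cinner x e * cinner e x = of_real ((cmod (cinner e x))\<^sup>2)" for e
    using cinner_commute[of x e] by (metis complex_norm_square mult.commute)
  then have "of_real (\<Sum>e\<in>B. (cmod (cinner e x))\<^sup>2) = (of_real ((norm x)\<^sup>2) :: complex)"
    using parseval[OF assms, of x x] by (simp add: cinner_self)
  then show ?thesis by (simp only: of_real_eq_iff)
qed

section \<open>Compactness in finite dimension\<close>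

text \<open>The type \<open>'a\<close> is not an instance of a class of finite-dimensional spaces, so compactness has to be
built up from that of discs in the complex plane, one coordinate at a time.\<close>
lemma compact_combinations:
  fixes B :: "'a::complex_inner set"
  assumes "finite B"
  shows "compact {x. \<exists>g. (\<forall>b\<in>B. cmod (g b) \<le> r) \<and> x = (\<Sum>b\<in>B. g b *\<^sub>C b)}"
  using assms
proof induction
  case empty
  then show ?case by simp
next
  case (insert b B)
  let ?K = "\<lambda>B. {x. \<exists>g. (\<forall>b\<in>B. cmod (g b) \<le> r) \<and> x = (\<Sum>b\<in>B. g b *\<^sub>C b :: 'a)}"
  have eq: "?K (insert b B) = (\<lambda>(a, x). a *\<^sub>C b + x) ` (cball 0 r \<times> ?K B)" (is "_ = ?R")
  proof (intro equalityI subsetI)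
    fix x assume "x \<in> ?K (insert b B)"
    then obtain g where "\<forall>b\<in>insert b B. cmod (g b) \<le> r" "x = (\<Sum>b\<in>insert b B. g b *\<^sub>C b)" by blast
    then show "x \<in> ?R"
      using insert by (intro image_eqI[of _ _ "(g b, \<Sum>b\<in>B. g b *\<^sub>C b)"]) auto
  next
    fix x assume "x \<in> ?R"
    then obtain a g where "cmod a \<le> r" "\<forall>b\<in>B. cmod (g b) \<le> r" "x = a *\<^sub>C b + (\<Sum>b\<in>B. g b *\<^sub>C b)"
      by auto
    moreover have "(\<Sum>c\<in>B. (g(b := a)) c *\<^sub>C c) = (\<Sum>b\<in>B. g b *\<^sub>C b)"
      using insert(2) by (intro sum.cong) auto
    ultimately show "x \<in> ?K (insert b B)"
      using insert by (intro CollectI exI[of _ "g(b := a)"]) auto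
  qed
  have "bounded_linear (\<lambda>a. a *\<^sub>C b)"
    by (rule bounded_linear_intro[of _ "norm b"])
      (simp_all add: complex_vector.scale_left_distrib norm_scaleC scaleR_conv_of_real
        flip: scaleC_of_real)
  then have "continuous_on X (\<lambda>p. fst p *\<^sub>C b + snd p)" for X :: "(complex \<times> 'a) set"
    by (intro continuous_on_add bounded_linear.continuous_on[of "\<lambda>a. a *\<^sub>C b"] continuous_intros)
  then show ?case
    unfolding eq case_prod_beta
    using insert by (intro compact_continuous_image compact_Times) auto
qed

lemma compact_closed_bounded:
  fixes C :: "'a::complex_inner set"
  assumes B: "orthonormal_basis (B :: 'a set)" and "closed C" and "\<And>x. x \<in> C \<Longrightarrow> norm x \<le> r"
  shows "compact C"
proof -
  let ?K = "{x. \<exists>g. (\<forall>b\<in>B. cmod (g b) \<le> r) \<and> x = (\<Sum>b\<in>B. g b *\<^sub>C b)}"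
  have "C \<subseteq> ?K"
  proof
    fix x assume x: "x \<in> C"
    have "cmod (cinner x b) \<le> r" if "b \<in> B" for b
    proof -
      have "(cmod (cinner b x))\<^sup>2 \<le> (\<Sum>e\<in>B. (cmod (cinner e x))\<^sup>2)"
        using B that by (intro member_le_sum) (auto simp: orthonormal_basis_def)
      then have "cmod (cinner b x) \<le> norm x"
        unfolding parseval_norm[OF B] by (rule power2_le_imp_le) simp
      moreover have "cmod (cinner b x) = cmod (cinner x b)"
        by (metis cinner_commute complex_mod_cnj)
      ultimately show ?thesis using assms(3)[OF x] by simp
    qed
    then show "x \<in> ?K"
      using orthonormal_basis_expand[OF B, of x] by (intro CollectI exI[of _ "cinner x"]) simp
  qed
  moreover have "compact ?K"
    using B by (intro compact_combinations) (auto simp: orthonormal_basis_def)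
  ultimately show ?thesis
    using assms(2) compact_Int_closed[of ?K C] by (simp add: Int_absorb1)
qed

section \<open>Real dimensions and ranks\<close>

text \<open>The vectors \<open>e\<close> and \<open>\<i>e\<close>, for \<open>e\<close> in a complex orthonormal basis, are pairwise orthogonal for the real
inner product.\<close>
lemma real_basis:
  fixes B :: "'a::complex_inner set"
  assumes B: "orthonormal_basis B"
  shows "span (B \<union> (*\<^sub>C) \<i> ` B) = UNIV" (is "span ?S = _")
    and "dim (UNIV :: 'a set) = 2 * cdim (UNIV :: 'a set)"
proof -
  have ortho: "orthonormal B" and fin: "finite B"
    using B by (auto simp: orthonormal_basis_def orthonormal_def)
  have "x \<in> span ?S" for x
  proof -
    have "a *\<^sub>C e \<in> span ?S" if "e \<in> B" for a e
    proof -
      have "a *\<^sub>C e = (of_real (Re a) + of_real (Im a) * \<i>) *\<^sub>C e"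
        by (simp add: complex_eq mult.commute)
      also have "\<dots> = Re a *\<^sub>R e + Im a *\<^sub>R (\<i> *\<^sub>C e)"
        by (simp add: complex_vector.scale_left_distrib flip: scaleC_of_real)
      also have "\<dots> \<in> span ?S"
        using that by (intro span_add span_scale span_base) auto
      finally show ?thesis .
    qed
    then have "(\<Sum>e\<in>B. cinner x e *\<^sub>C e) \<in> span ?S"
      by (intro span_sum)
    then show ?thesis
      using orthonormal_basis_expand[OF B, of x] by simp
  qed
  then show sp: "span ?S = UNIV" by blast
  have inner: "e \<bullet> e' = (if e = e' then 1 else 0)" "e \<bullet> (\<i> *\<^sub>C e') = 0" "(\<i> *\<^sub>C e) \<bullet> e' = 0"
    "(\<i> *\<^sub>C e) \<bullet> (\<i> *\<^sub>C e') = (if e = e' then 1 else 0)" if "e \<in> B" "e' \<in> B" for e e'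
    using ortho that
    by (auto simp: orthonormal_def cinner_scaleC_left cinner_scaleC_right simp flip: Re_cinner)
  have nz: "e \<noteq> 0" if "e \<in> B" for e
    using inner(1)[OF that that] by auto
  have disj: "e \<noteq> \<i> *\<^sub>C e'" if "e \<in> B" "e' \<in> B" for e e'
    using inner(1)[OF that(1,1)] inner(2)[OF that] by auto
  have "independent ?S"
  proof (rule pairwise_orthogonal_independent)
    show "pairwise orthogonal ?S"
      unfolding pairwise_def orthogonal_def by (auto simp: inner)
    show "0 \<notin> ?S"
      using nz by (metis UnE image_iff complex_vector.scale_eq_0_iff complex_i_not_zero)
  qed
  then have "dim (UNIV :: 'a set) = card ?S"
    using sp by (intro dim_unique) auto
  also have "\<dots> = card B + card ((*\<^sub>C) \<i> ` B)"
  proof (intro card_Un_disjoint)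
    show "B \<inter> (*\<^sub>C) \<i> ` B = {}"
      using disj by blast
  qed (use fin in auto)
  also have "card ((*\<^sub>C) \<i> ` B) = card B"
    by (intro card_image) (auto simp: inj_on_def)
  also have "card B = cdim (UNIV :: 'a set)"
    using B orthonormal_independent[OF ortho]
    by (intro complex_vector.dim_eq_card[symmetric]) (auto simp: orthonormal_basis_def)
  finally show "dim (UNIV :: 'a set) = 2 * cdim (UNIV :: 'a set)" by simp
qed

text \<open>Extend a basis \<open>B\<close> of the kernel to a basis \<open>C\<close> of the whole space; \<open>T\<close> maps \<open>C - B\<close> injectively onto a
basis of its range. Finite dimension is expressed by a finite spanning set, which makes the result
applicable to types without a fixed finite basis.\<close>
lemma rank_nullity:
  fixes T :: "'a::real_vector \<Rightarrow> 'b::real_vector" and S :: "'a set"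
  assumes T: "linear T" and S: "finite S" "span S = UNIV"
  shows "dim {x. T x = 0} + dim (range T) = dim (UNIV :: 'a set)"
proof -
  interpret T: linear T by (fact T)
  let ?K = "{x. T x = 0}"
  obtain B where B: "B \<subseteq> ?K" "independent B" "?K \<subseteq> span B"
    using real_vector.maximal_independent_subset[of ?K] by blast
  define C where "C = real_vector.extend_basis B"
  have C: "B \<subseteq> C" "independent C" "span C = UNIV"
    unfolding C_def
    using B(2) by (simp_all add: real_vector.extend_basis_superset real_vector.independent_extend_basis)
  have fin: "finite C"
    using real_vector.independent_span_bound[OF S(1) C(2)] S(2) by auto
  have ker: "x = 0" if x: "x \<in> span (C - B)" "T x = 0" for x
  proof -
    have "x \<in> span B" using B(3) x(2) by blast
    then obtain p where p: "x = (\<Sum>v\<in>B. p v *\<^sub>R v)"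
      using real_vector.span_finite[of B] fin C(1) finite_subset by blast
    obtain q where q: "x = (\<Sum>v\<in>C - B. q v *\<^sub>R v)"
      using x(1) real_vector.span_finite[of "C - B"] fin by blast
    define g where "g v = (if v \<in> B then p v else - q v)" for v
    have "(\<Sum>v\<in>C. g v *\<^sub>R v) = (\<Sum>v\<in>C - B. g v *\<^sub>R v) + (\<Sum>v\<in>B. g v *\<^sub>R v)"
      by (rule sum.subset_diff[OF C(1) fin])
    also have "\<dots> = - (\<Sum>v\<in>C - B. q v *\<^sub>R v) + (\<Sum>v\<in>B. p v *\<^sub>R v)"
      by (simp add: g_def sum_negf)
    also have "\<dots> = 0" using p q by simp
    finally have "\<forall>v\<in>C. g v = 0"
      using C(2) fin real_vector.independent_explicit_finite_subsets[of C] by blast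
    then have "p v = 0" if "v \<in> B" for v
      using that C(1) unfolding g_def by (metis subsetD)
    then show "x = 0" using p by simp
  qed
  have inj: "inj_on T (span (C - B))"
  proof (rule inj_onI)
    fix x y assume xy: "x \<in> span (C - B)" "y \<in> span (C - B)" "T x = T y"
    then have "x - y = 0" by (intro ker) (simp_all add: span_diff T.diff)
    then show "x = y" by simp
  qed
  have ind: "independent (T ` (C - B))"
    using real_vector.independent_mono[OF C(2), of "C - B"]
    by (intro real_vector.linear_independent_injective_image[OF T _ inj]) auto
  have "range T = T ` span C" using C(3) by simp
  also have "\<dots> = span (T ` C)" by (rule linear_span_image[OF T, symmetric])
  also have "\<dots> \<subseteq> span (T ` (C - B))"
  proof (rule real_vector.span_minimal)
    show "T ` C \<subseteq> span (T ` (C - B))"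
    proof (intro image_subsetI)
      fix x assume "x \<in> C"
      then show "T x \<in> span (T ` (C - B))"
        using B(1) by (cases "x \<in> B") (auto intro: span_base simp: span_zero)
    qed
  qed simp
  finally have "dim (range T) = card (T ` (C - B))"
    using ind by (intro dim_unique) auto
  also have "\<dots> = card (C - B)"
    by (intro card_image inj_on_subset[OF inj] span_superset)
  finally have "dim (range T) = card (C - B)" .
  moreover have "dim ?K = card B" "dim (UNIV :: 'a set) = card C"
    using B C by (auto intro: dim_unique[of B] dim_unique[of C])
  moreover have "card C = card B + card (C - B)"
    using C(1) fin by (metis card_Un_disjoint Diff_disjoint Diff_partition finite_Diff finite_subset)
  ultimately show ?thesis by simp
qed

text \<open>Both facts come from extending \<open>{x}\<close> to a basis of \<open>K\<close>.\<close>
lemma subset_span_singleton_of_dim_1: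
  fixes K S :: "'a::real_vector set"
  assumes "finite S" "K \<subseteq> span S" "x \<in> K" "x \<noteq> 0"
  shows "1 \<le> dim K" and "dim K = 1 \<Longrightarrow> K \<subseteq> span {x}"
proof -
  obtain B where B: "{x} \<subseteq> B" "B \<subseteq> K" "independent B" "K \<subseteq> span B"
    using real_vector.maximal_independent_subset_extend[of "{x}" K] assms(3,4) by auto
  have "finite B"
    using real_vector.independent_span_bound[OF assms(1) B(3)] B(2) assms(2) by blast
  moreover have dim: "dim K = card B"
    using B by (intro dim_unique) auto
  ultimately show "1 \<le> dim K"
    using B(1) card_mono[of B "{x}"] by simp
  show "K \<subseteq> span {x}" if "dim K = 1"
  proof -
    have "B = {x}"
      using dim that B(1) by (metis card_1_singletonE insert_subset singletonD)
    with B(4) show ?thesis by simp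
  qed
qed

section \<open>The two quadratic forms\<close>

text \<open>By the lemma \<open>phase_gap_imag_component\<close> below this is \<open>\<parallel>u\<parallel>\<^sup>2\<close> times the squared distance of \<open>v\<close> from the
real line through \<open>\<i>u\<close>.\<close>
definition phase_gap :: "'a::complex_inner \<Rightarrow> 'a \<Rightarrow> real" where
  "phase_gap u v = (norm u)\<^sup>2 * (norm v)\<^sup>2 - (Im (cinner u v))\<^sup>2"

text \<open>Orthogonal decomposition of \<open>v\<close> along \<open>\<i>u\<close> for the real inner product: \<open>Im \<langle>u, w\<rangle> = 0\<close> says that
\<open>w\<close> is orthogonal to \<open>\<i>u\<close>.\<close>
lemma imag_component:
  fixes u v :: "'a::complex_inner"
  assumes "u \<noteq> 0"
  obtains t w where "v = t *\<^sub>R (\<i> *\<^sub>C u) + w" "Im (cinner u w) = 0"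
proof
  define t where "t = - Im (cinner u v) / (norm u)\<^sup>2"
  show "v = t *\<^sub>R (\<i> *\<^sub>C u) + (v - t *\<^sub>R (\<i> *\<^sub>C u))" by simp
  have "Im (cinner u (v - t *\<^sub>R (\<i> *\<^sub>C u))) = Im (cinner u v) + t * (norm u)\<^sup>2"
    by (simp add: cinner_diff_right cinner_scaleR_right cinner_scaleC_right cinner_self
        del: of_real_power)
  then show "Im (cinner u (v - t *\<^sub>R (\<i> *\<^sub>C u))) = 0"
    using assms by (simp add: t_def)
qed

lemma phase_gap_imag_component:
  assumes "Im (cinner u w) = 0"
  shows "phase_gap u (t *\<^sub>R (\<i> *\<^sub>C u) + w) = (norm u)\<^sup>2 * (norm w)\<^sup>2"
proof -
  have "(\<i> *\<^sub>C u) \<bullet> w = 0"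
    using assms Re_scaleC_i[of u w] by (simp add: Re_cinner)
  then have "(norm (t *\<^sub>R (\<i> *\<^sub>C u) + w))\<^sup>2 = t\<^sup>2 * (norm u)\<^sup>2 + (norm w)\<^sup>2"
    by (simp add: norm_add_Pythagorean orthogonal_def norm_scaleC power_mult_distrib)
  moreover have "Im (cinner u (t *\<^sub>R (\<i> *\<^sub>C u) + w)) = - t * (norm u)\<^sup>2"
    using assms by (simp add: cinner_add_right cinner_scaleR_right cinner_scaleC_right cinner_self
        del: of_real_power)
  ultimately show ?thesis
    by (simp add: phase_gap_def algebra_simps power2_eq_square)
qed

lemma phase_gap_nonneg: "0 \<le> phase_gap u v"
proof (cases "u = 0")
  case False
  then show ?thesis
    by (metis imag_component phase_gap_imag_component mult_nonneg_nonneg zero_le_power2)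
qed (simp add: phase_gap_def)

lemma phase_gap_eq_0_iff:
  assumes "u \<noteq> 0"
  shows "phase_gap u v = 0 \<longleftrightarrow> (\<exists>t. v = t *\<^sub>R (\<i> *\<^sub>C u))"
proof
  assume gap: "phase_gap u v = 0"
  obtain t w where tw: "v = t *\<^sub>R (\<i> *\<^sub>C u) + w" "Im (cinner u w) = 0"
    using imag_component[OF assms] .
  then have "(norm u)\<^sup>2 * (norm w)\<^sup>2 = 0"
    using phase_gap_imag_component[OF tw(2), of t] gap by simp
  with tw assms show "\<exists>t. v = t *\<^sub>R (\<i> *\<^sub>C u)" by auto
next
  assume "\<exists>t. v = t *\<^sub>R (\<i> *\<^sub>C u)"
  then show "phase_gap u v = 0"
    using phase_gap_imag_component[of u 0] by auto
qed

definition frame_form :: "(nat \<Rightarrow> 'a::complex_inner) \<Rightarrow> nat \<Rightarrow> 'a \<Rightarrow> 'a \<Rightarrow> real" where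
  "frame_form f m u v = (\<Sum>k=1..m. (Re (cinner u (f k) * cinner (f k) v))\<^sup>2)"

lemma frame_form_eq_0_iff:
  "frame_form f m u v = 0 \<longleftrightarrow> (\<forall>k\<in>{1..m}. Re (cinner u (f k) * cinner (f k) v) = 0)"
  unfolding frame_form_def by (subst sum_nonneg_eq_0_iff) auto

lemma Re_cinner_product_commute:
  "Re (cinner v g * cinner g u) = Re (cinner u g * cinner g v)"
proof -
  have "cinner v g * cinner g u = cnj (cinner u g * cinner g v)"
    by (simp add: mult.commute flip: cinner_commute)
  then show ?thesis by simp
qed

text \<open>The product \<open>\<langle>u, g\<rangle>\<langle>g, \<i>u\<rangle> = -\<i> \<bar>\<langle>u, g\<rangle>\<bar>\<^sup>2\<close> is purely imaginary, so the direction \<open>\<i>u\<close> is invisible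
to every term of the sum.\<close>
lemma frame_form_imag_component:
  "frame_form f m u (t *\<^sub>R (\<i> *\<^sub>C u) + w) = frame_form f m u w"
proof -
  have "Re (cinner u g * cinner g (t *\<^sub>R (\<i> *\<^sub>C u) + w)) = Re (cinner u g * cinner g w)" for g
  proof -
    have "cinner u g * cinner g (\<i> *\<^sub>C u) = of_real ((cmod (cinner u g))\<^sup>2) * (- \<i>)"
      unfolding complex_norm_square using cinner_commute[of g u] by (simp add: cinner_scaleC_right)
    then have "Re (cinner u g * cinner g (\<i> *\<^sub>C u)) = 0"
      by (simp only: Re_complex_of_real times_complex.simps) simp
    then show ?thesis
      by (simp add: cinner_add_right cinner_scaleR_right algebra_simps)
  qed
  then show ?thesis by (simp add: frame_form_def)
qed

lemma frame_form_scaleR: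
  "frame_form f m (r *\<^sub>R u) (s *\<^sub>R v) = r\<^sup>2 * s\<^sup>2 * frame_form f m u v"
proof -
  have "Re (cinner (r *\<^sub>R u) g * cinner g (s *\<^sub>R v)) = r * s * Re (cinner u g * cinner g v)" for g
    by (simp add: cinner_scaleR_left cinner_scaleR_right algebra_simps)
  then show ?thesis
    by (simp only: frame_form_def power_mult_distrib sum_distrib_left)
qed

section \<open>Injectivity as definiteness\<close>

text \<open>If \<open>y = zx\<close> with \<open>\<bar>z\<bar> = 1\<close>, then \<open>x + y\<close> and \<open>x - y\<close> are the multiples of \<open>x\<close> by \<open>1 + z\<close> and \<open>1 - z\<close>,
and both terms of the gap equal \<open>4 (Im z)\<^sup>2 \<parallel>x\<parallel>\<^sup>4\<close>. Conversely, unless \<open>y = -x\<close>, \<open>x - y = s(x + y)\<close> with \<open>s\<close>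
purely imaginary, and the Cayley transform \<open>(1 - s) / (1 + s)\<close> is the phase that takes \<open>x\<close> to \<open>y\<close>.\<close>
lemma phase_rel_iff: "(x, y) \<in> phase_rel \<longleftrightarrow> phase_gap (x + y) (x - y) = 0"
proof
  assume "(x, y) \<in> phase_rel"
  then obtain z where z: "cmod z = 1" "y = z *\<^sub>C x"
    by (auto simp: phase_rel_def)
  have zz: "(Re z)\<^sup>2 + (Im z)\<^sup>2 = 1"
    using z(1) by (simp add: cmod_power2[symmetric])
  have u: "x + y = (1 + z) *\<^sub>C x" and v: "x - y = (1 - z) *\<^sub>C x"
    by (simp_all add: z complex_vector.scale_left_distrib complex_vector.scale_left_diff_distrib)
  have "(cmod (1 + z))\<^sup>2 = 2 + 2 * Re z" "(cmod (1 - z))\<^sup>2 = 2 - 2 * Re z"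
    unfolding cmod_power2 using zz by (simp_all add: power2_eq_square algebra_simps)
  moreover have "Im (cinner ((1 + z) *\<^sub>C x) ((1 - z) *\<^sub>C x)) = 2 * Im z * (norm x)\<^sup>2"
  proof -
    have "cinner ((1 + z) *\<^sub>C x) ((1 - z) *\<^sub>C x) = (1 + z) * cnj (1 - z) * of_real ((norm x)\<^sup>2)"
      by (simp only: cinner_scaleC_left cinner_scaleC_right cinner_self mult_ac)
    moreover have "Im ((1 + z) * cnj (1 - z)) = 2 * Im z"
      by (simp add: algebra_simps)
    ultimately show ?thesis
      by (simp only: times_complex.sel Re_complex_of_real Im_complex_of_real mult_zero_right add_0)
  qed
  ultimately have "phase_gap (x + y) (x - y) =
      ((2 + 2 * Re z) * (2 - 2 * Re z) - (2 * Im z)\<^sup>2) * ((norm x)\<^sup>2)\<^sup>2"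
    unfolding u v phase_gap_def norm_scaleC power_mult_distrib
    by (simp only:) (simp add: algebra_simps power2_eq_square)
  also have "(2 + 2 * Re z) * (2 - 2 * Re z) - (2 * Im z)\<^sup>2 = 4 * (1 - ((Re z)\<^sup>2 + (Im z)\<^sup>2))"
    by (simp add: algebra_simps power2_eq_square)
  finally show "phase_gap (x + y) (x - y) = 0" by (simp add: zz)
next
  assume gap: "phase_gap (x + y) (x - y) = 0"
  show "(x, y) \<in> phase_rel"
  proof (cases "x + y = 0")
    case True
    then have "y = (- 1) *\<^sub>C x"
      by (simp add: eq_neg_iff_add_eq_0 add.commute)
    then show ?thesis
      unfolding phase_rel_def by (intro CollectI case_prodI exI[of _ "- 1"]) simp
  next
    case False
    then obtain t where t: "x - y = t *\<^sub>R (\<i> *\<^sub>C (x + y))"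
      using gap phase_gap_eq_0_iff by blast
    define s where "s = of_real t * \<i>"
    have "x - y = s *\<^sub>C (x + y)"
      by (simp add: t s_def scaleC_of_real[symmetric])
    then have eq: "(1 + s) *\<^sub>C y = (1 - s) *\<^sub>C x"
      by (simp add: algebra_simps complex_vector.scale_left_distrib
          complex_vector.scale_left_diff_distrib complex_vector.scale_right_distrib)
    have s: "1 + s \<noteq> 0" "cmod (1 - s) = cmod (1 + s)"
      by (auto simp: s_def complex_eq_iff cmod_def)
    have "y = (inverse (1 + s) * (1 + s)) *\<^sub>C y"
      using s(1) by simp
    also have "\<dots> = (inverse (1 + s) * (1 - s)) *\<^sub>C x"
      by (metis eq complex_vector.scale_scale)
    finally have "y = (inverse (1 + s) * (1 - s)) *\<^sub>C x" .
    moreover have "cmod (inverse (1 + s) * (1 - s)) = 1"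
      using s by (simp add: norm_mult norm_inverse)
    ultimately show ?thesis
      unfolding phase_rel_def by blast
  qed
qed

lemma magnitude_diff:
  "(cmod (cinner x g))\<^sup>2 - (cmod (cinner y g))\<^sup>2 = Re (cinner (x + y) g * cinner g (x - y))"
proof -
  have "cinner g (x - y) = cnj (cinner x g - cinner y g)"
    by (simp add: cinner_diff_right flip: cinner_commute)
  moreover have "(cmod p)\<^sup>2 - (cmod q)\<^sup>2 = Re ((p + q) * cnj (p - q))" for p q
    unfolding cmod_power2 by (simp add: power2_eq_square algebra_simps)
  ultimately show ?thesis
    by (simp only: cinner_add_left)
qed

text \<open>The pairs \<open>(x, y)\<close> are in bijection with the pairs \<open>(u, v) = (x + y, x - y)\<close>.\<close>
lemma inj_alpha_iff:
  "inj_on (alpha f m) Hhat \<longleftrightarrow> (\<forall>u v. frame_form f m u v = 0 \<longrightarrow> phase_gap u v = 0)"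
proof -
  have "inj_on (alpha f m) Hhat \<longleftrightarrow>
      (\<forall>x y. alpha f m (phase_rel `` {x}) = alpha f m (phase_rel `` {y}) \<longrightarrow> (x, y) \<in> phase_rel)"
    unfolding inj_on_def Hhat_def quotient_def
    by (auto simp: eq_equiv_class_iff[OF equiv_phase_rel])
  also have "\<dots> \<longleftrightarrow> (\<forall>x y. frame_form f m (x + y) (x - y) = 0 \<longrightarrow> phase_gap (x + y) (x - y) = 0)"
  proof -
    have "alpha f m (phase_rel `` {x}) = alpha f m (phase_rel `` {y}) \<longleftrightarrow>
        frame_form f m (x + y) (x - y) = 0" for x y
      unfolding alpha_class frame_form_eq_0_iff magnitude_diff[symmetric]
      by (auto simp: restrict_def fun_eq_iff)
    then show ?thesis by (simp only: phase_rel_iff)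
  qed
  also have "\<dots> \<longleftrightarrow> (\<forall>u v. frame_form f m u v = 0 \<longrightarrow> phase_gap u v = 0)"
  proof -
    have "\<exists>x y. u = x + y \<and> v = x - y" for u v :: 'a
      by (rule exI[of _ "(1/2) *\<^sub>R (u + v)"], rule exI[of _ "(1/2) *\<^sub>R (u - v)"])
        (simp add: algebra_simps flip: scaleR_add_left)
    then show ?thesis by metis
  qed
  finally show ?thesis .
qed

section \<open>The uniform lower bound\<close>

text \<open>On the compact set \<open>?C\<close> the gap is 1, so there the hypothesis makes the continuous function \<open>frame_form\<close>
positive and its minimum is the constant. Homogeneity and invariance under \<open>v \<mapsto> v + t\<i>u\<close> carry the
estimate to all pairs.\<close>
lemma frame_form_lower_bound:
  fixes f :: "nat \<Rightarrow> 'a::complex_inner"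
  assumes B: "orthonormal_basis (B :: 'a set)"
    and def: "\<And>u v. frame_form f m u v = 0 \<Longrightarrow> phase_gap u v = 0"
  shows "\<exists>a>0. \<forall>u v. a * phase_gap u v \<le> frame_form f m u v"
proof -
  let ?C = "(sphere 0 1 \<times> sphere 0 1) \<inter> {p. Im (cinner (fst p) (snd p :: 'a)) = 0}"
  let ?F = "\<lambda>p. frame_form f m (fst p) (snd p)"
  have "compact (sphere 0 1 :: 'a set)"
  proof (rule compact_closed_bounded[OF B])
    have "sphere 0 1 = {x :: 'a. norm x = 1}" by auto
    then show "closed (sphere 0 1 :: 'a set)"
      by (simp add: closed_Collect_eq continuous_intros)
    show "norm x \<le> 1" if "x \<in> sphere 0 1" for x :: 'a
      using that by simp
  qed
  then have comp: "compact ?C"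
    by (intro compact_Int_closed compact_Times closed_Collect_eq continuous_intros)
  have cont: "continuous_on ?C ?F"
    unfolding frame_form_def by (intro continuous_intros)
  have pos: "0 < ?F p" if "p \<in> ?C" for p
  proof -
    have "phase_gap (fst p) (snd p) = 1"
      using that by (auto simp: phase_gap_def)
    then have "?F p \<noteq> 0" using def by force
    moreover have "0 \<le> ?F p" unfolding frame_form_def by (intro sum_nonneg) simp
    ultimately show ?thesis by simp
  qed
  \<comment> \<open>In dimension 0 the set is empty; any positive constant then serves.\<close>
  obtain a where a: "a > 0" "\<And>p. p \<in> ?C \<Longrightarrow> a \<le> ?F p"
  proof (cases "?C = {}")
    case True
    show ?thesis by (rule that[of 1]) (use True in auto)
  next
    case False
    then obtain p where "p \<in> ?C" "\<forall>q\<in>?C. ?F p \<le> ?F q"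
      using continuous_attains_inf[OF comp False cont] by blast
    then show ?thesis using that pos by blast
  qed
  have "a * phase_gap u v \<le> frame_form f m u v" for u v
  proof (cases "u = 0")
    case True
    then show ?thesis by (simp add: phase_gap_def frame_form_def sum_nonneg)
  next
    case False
    obtain t w where v: "v = t *\<^sub>R (\<i> *\<^sub>C u) + w" and w: "Im (cinner u w) = 0"
      using imag_component[OF False] .
    have "a * ((norm u)\<^sup>2 * (norm w)\<^sup>2) \<le> frame_form f m u w"
    proof (cases "w = 0")
      case True
      then show ?thesis by (simp add: frame_form_def sum_nonneg)
    next
      case w0: False
      have uw: "u = norm u *\<^sub>R sgn u" "w = norm w *\<^sub>R sgn w"
        using False w0 by (simp_all add: sgn_div_norm)
      have "(sgn u, sgn w) \<in> ?C"
        using False w0 w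
        by (simp add: norm_sgn) (simp add: sgn_div_norm cinner_scaleR_left cinner_scaleR_right)
      then have "a \<le> frame_form f m (sgn u) (sgn w)"
        using a(2) by fastforce
      then have "a * ((norm u)\<^sup>2 * (norm w)\<^sup>2) \<le> (norm u)\<^sup>2 * (norm w)\<^sup>2 * frame_form f m (sgn u) (sgn w)"
        by (subst mult.commute) (intro mult_left_mono, auto)
      then show ?thesis
        using frame_form_scaleR[of f m "norm u" "sgn u" "norm w" "sgn w"] uw by simp
    qed
    then show ?thesis
      by (simp add: v phase_gap_imag_component[OF w] frame_form_imag_component)
  qed
  with a(1) show ?thesis by blast
qed

lemma definite_iff_lower_bound:
  fixes f :: "nat \<Rightarrow> 'a::complex_inner"
  assumes B: "orthonormal_basis (B :: 'a set)"
  shows "(\<forall>u v. frame_form f m u v = 0 \<longrightarrow> phase_gap u v = 0) \<longleftrightarrow>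
    (\<exists>a>0. \<forall>u v. a * phase_gap u v \<le> frame_form f m u v)"
proof
  assume "\<exists>a>0. \<forall>u v. a * phase_gap u v \<le> frame_form f m u v"
  then obtain a where a: "a > 0" "\<And>u v. a * phase_gap u v \<le> frame_form f m u v" by blast
  show "\<forall>u v. frame_form f m u v = 0 \<longrightarrow> phase_gap u v = 0"
  proof (intro allI impI)
    fix u v assume "frame_form f m u v = 0"
    then have "phase_gap u v \<le> 0" using a by (metis mult_le_0_iff not_less)
    then show "phase_gap u v = 0" using phase_gap_nonneg[of u v] by simp
  qed
qed (use frame_form_lower_bound[OF B] in blast)

section \<open>Trace and nuclear norm of symmetrised outer products\<close>

definition selfadjoint :: "('a::complex_inner \<Rightarrow> 'a) \<Rightarrow> bool" where
  "selfadjoint T \<longleftrightarrow> (\<forall>x y. cinner (T x) y = cinner x (T y))"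

text \<open>The adjoint is given by a choice, but at most one operator satisfies its defining identity.\<close>
lemma cadjoint_selfadjoint:
  assumes "selfadjoint T"
  shows "cadjoint T = T"
proof
  fix y
  have "\<forall>x y. cinner (T x) y = cinner x (cadjoint T y)"
    unfolding cadjoint_def
    by (rule someI[of "\<lambda>S. \<forall>x y. cinner (T x) y = cinner x (S y)" T])
      (use assms in \<open>simp add: selfadjoint_def\<close>)
  then show "cadjoint T y = T y"
    using assms by (metis cinner_cancel_right selfadjoint_def)
qed

lemma selfadjoint_sym_couter: "selfadjoint (sym_couter u v)"
  unfolding selfadjoint_def sym_couter_def couter_def
  by (simp add: cinner_add_left cinner_add_right cinner_scaleC_left cinner_scaleC_right
      flip: cinner_commute)

text \<open>The trace of \<open>gg\<^sup>*S\<close> is \<open>\<langle>Sg, g\<rangle>\<close>, by Parseval's identity in whichever orthonormal basis the trace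
refers to.\<close>
lemma op_inner_couter_selfadjoint:
  assumes "\<exists>B. orthonormal_basis (B :: 'a::complex_inner set)" "selfadjoint S"
  shows "op_inner (couter g g) S = cinner (S g) (g :: 'a)"
proof -
  define B where "B = (SOME B. orthonormal_basis (B :: 'a set))"
  have B: "orthonormal_basis B"
    unfolding B_def using assms(1) by (rule someI_ex)
  have "op_inner (couter g g) S = (\<Sum>e\<in>B. cinner (S e) g * cinner g e)"
    by (simp add: op_inner_def ctrace_def B_def[symmetric] couter_def cinner_scaleC_left
        cadjoint_selfadjoint[OF assms(2)])
  also have "\<dots> = (\<Sum>e\<in>B. cinner g e * cinner e (S g))"
    using assms(2) by (simp add: selfadjoint_def mult.commute)
  also have "\<dots> = cinner g (S g)"
    by (rule parseval[OF B])
  finally show ?thesis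
    using assms(2) by (simp add: selfadjoint_def)
qed

lemma cinner_sym_couter:
  "cinner (sym_couter u v g) g = of_real (Re (cinner u g * cinner g v))"
proof -
  have "cinner (sym_couter u v g) g =
      (cinner u g * cinner g v + cnj (cinner u g * cinner g v)) / 2"
    by (simp add: sym_couter_def couter_def cinner_add_left cinner_scaleC_left algebra_simps
        flip: cinner_commute)
  then show ?thesis unfolding complex_eq_iff by (auto simp: algebra_simps)
qed

lemma cmod_op_inner_sym_couter:
  assumes "\<exists>B. orthonormal_basis (B :: 'a::complex_inner set)"
  shows "(cmod (op_inner (couter g g) (sym_couter u v)))\<^sup>2 = (Re (cinner u g * cinner g (v :: 'a)))\<^sup>2"
  unfolding op_inner_couter_selfadjoint[OF assms selfadjoint_sym_couter] cinner_sym_couter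
  by (simp only: norm_of_real power2_abs)

text \<open>In an orthonormal eigenbasis, the eigenspace of \<open>T\<^sup>*T = T\<^sup>2\<close> for \<open>s\<^sup>2\<close> is spanned by the basis vectors
whose eigenvalue has absolute value \<open>s\<close>. Summing the singular values with multiplicity therefore sums
the \<open>\<bar>l e\<bar>\<close>, grouped by their value.\<close>
lemma nuclear_norm_diagonal:
  fixes T :: "'a::complex_inner \<Rightarrow> 'a" and l :: "'a \<Rightarrow> real"
  assumes B: "orthonormal_basis B"
    and T: "selfadjoint T"
    and diag: "\<And>e. e \<in> B \<Longrightarrow> T e = of_real (l e) *\<^sub>C e"
  shows "nuclear_norm T = (\<Sum>e\<in>B. \<bar>l e\<bar>)"
proof -
  have ortho: "orthonormal B" and fin: "finite B"
    using B by (auto simp: orthonormal_basis_def orthonormal_def)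
  have coord_eq: "x = y" if "\<And>e. e \<in> B \<Longrightarrow> cinner x e = cinner y e" for x y
    using that orthonormal_basis_expand[OF B, of x] orthonormal_basis_expand[OF B, of y]
    by (metis (mono_tags, lifting) sum.cong)
  have TT: "cinner (T (T x)) e = of_real ((l e)\<^sup>2) * cinner x e" if "e \<in> B" for x e
  proof -
    have "cinner (T y) e = of_real (l e) * cinner y e" for y
      using T diag[OF that] by (simp add: selfadjoint_def cinner_scaleC_right)
    then show ?thesis by (simp add: power2_eq_square)
  qed
  have eigen: "T (T x) = of_real (s\<^sup>2) *\<^sub>C x \<longleftrightarrow> (\<forall>e\<in>B. \<bar>l e\<bar> = s \<or> cinner x e = 0)"
    if "0 \<le> s" for s x
  proof -
    have "T (T x) = of_real (s\<^sup>2) *\<^sub>C x \<longleftrightarrow>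
        (\<forall>e\<in>B. cinner (T (T x)) e = cinner (of_real (s\<^sup>2) *\<^sub>C x) e)"
      using coord_eq by metis
    also have "\<dots> \<longleftrightarrow> (\<forall>e\<in>B. (l e)\<^sup>2 = s\<^sup>2 \<or> cinner x e = 0)"
      by (intro ball_cong refl) (auto simp: TT cinner_scaleC_left simp flip: of_real_power)
    also have "\<dots> \<longleftrightarrow> (\<forall>e\<in>B. \<bar>l e\<bar> = s \<or> cinner x e = 0)"
      using that power2_eq_iff_nonneg[of "\<bar>l _\<bar>" s] by simp
    finally show ?thesis .
  qed
  let ?E = "\<lambda>s. {x. cadjoint T (T x) = complex_of_real (s\<^sup>2) *\<^sub>C x}"
  have E: "?E s = {x. \<forall>e\<in>B. \<bar>l e\<bar> = s \<or> cinner x e = 0}" if "0 \<le> s" for s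
    using eigen[OF that] by (simp add: cadjoint_selfadjoint[OF T])
  have dimE: "cdim (?E s) = card {e \<in> B. \<bar>l e\<bar> = s}" if "0 \<le> s" for s
  proof (rule complex_vector.dim_unique)
    let ?A = "{e \<in> B. \<bar>l e\<bar> = s}"
    show "?A \<subseteq> ?E s"
      unfolding E[OF that] using ortho by (auto simp: orthonormal_def split: if_splits)
    show "?E s \<subseteq> cspan ?A"
    proof
      fix x assume "x \<in> ?E s"
      then have "cinner x e *\<^sub>C e = 0" if "e \<in> B - ?A" for e
        using that unfolding E[OF \<open>0 \<le> s\<close>] by auto
      then have "(\<Sum>e\<in>?A. cinner x e *\<^sub>C e) = (\<Sum>e\<in>B. cinner x e *\<^sub>C e)"
        using fin by (intro sum.mono_neutral_left) auto
      then have "x = (\<Sum>e\<in>?A. cinner x e *\<^sub>C e)"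
        using orthonormal_basis_expand[OF B, of x] by simp
      also have "\<dots> \<in> cspan ?A"
        by (intro complex_vector.span_sum complex_vector.span_scale complex_vector.span_base)
      finally show "x \<in> cspan ?A" .
    qed
    have "orthonormal ?A" using ortho by (auto simp: orthonormal_def)
    then show "\<not> complex_vector.dependent ?A" by (rule orthonormal_independent)
  qed simp
  have sv: "singular_values T = (\<lambda>e. \<bar>l e\<bar>) ` B"
  proof (intro equalityI subsetI)
    fix s assume "s \<in> singular_values T"
    then obtain x where x: "0 \<le> s" "x \<noteq> 0" "x \<in> ?E s"
      by (auto simp: singular_values_def)
    then show "s \<in> (\<lambda>e. \<bar>l e\<bar>) ` B"
      using coord_eq[of x 0] unfolding E[OF x(1)] by fastforce
  next
    fix s assume "s \<in> (\<lambda>e. \<bar>l e\<bar>) ` B"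
    then obtain e where e: "e \<in> B" "s = \<bar>l e\<bar>" by blast
    then have "0 \<le> s" by simp
    moreover have "e \<in> ?E s"
      unfolding E[OF \<open>0 \<le> s\<close>] using ortho e by (auto simp: orthonormal_def)
    moreover have "e \<noteq> 0"
      using ortho e by (metis cinner_zero_left orthonormal_def zero_neq_one)
    ultimately show "s \<in> singular_values T"
      by (auto simp: singular_values_def)
  qed
  have "nuclear_norm T = (\<Sum>s\<in>(\<lambda>e. \<bar>l e\<bar>) ` B. \<Sum>e\<in>{e \<in> B. \<bar>l e\<bar> = s}. \<bar>l e\<bar>)"
    unfolding nuclear_norm_def sv
  proof (rule sum.cong[OF refl])
    fix s assume "s \<in> (\<lambda>e. \<bar>l e\<bar>) ` B"
    then have "0 \<le> s" by auto
    then show "real (cdim (?E s)) * s = (\<Sum>e\<in>{e \<in> B. \<bar>l e\<bar> = s}. \<bar>l e\<bar>)"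
      unfolding dimE[OF \<open>0 \<le> s\<close>] by simp
  qed
  then show ?thesis
    by (simp only: sum.image_gen[OF fin, symmetric])
qed

text \<open>Normalising \<open>a\<close> and \<open>b\<close> and extending to an orthonormal basis diagonalises \<open>T\<close>. Each basis vector is
orthogonal to \<open>a\<close> or to \<open>b\<close>, so no cancellation occurs in the absolute values of the eigenvalues, and
Parseval's identity sums them. Zero vectors are allowed: \<open>sgn 0 = 0\<close> is left out of the basis.\<close>
lemma nuclear_norm_orthogonal_difference:
  fixes a b :: "'a::complex_inner"
  assumes "\<exists>S :: 'a set. finite S \<and> cspan S = UNIV"
    and ab: "cinner a b = 0" and T: "selfadjoint T"
    and T_eq: "\<And>x. T x = r *\<^sub>R (couter a a x - couter b b x)"
  shows "nuclear_norm T = \<bar>r\<bar> * ((norm a)\<^sup>2 + (norm b)\<^sup>2)"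
proof -
  have ba: "cinner b a = 0"
    using ab cinner_commute[of b a] by simp
  have self: "cinner (sgn x) (sgn x) = 1" if "x \<noteq> 0" for x :: 'a
    using that by (simp add: cinner_self norm_sgn)
  have "orthonormal ({sgn a, sgn b} - {0})"
    using ab ba self
    by (auto simp: orthonormal_def sgn_zero_iff sgn_div_norm cinner_scaleR_left cinner_scaleR_right)
  then obtain B where B: "{sgn a, sgn b} - {0} \<subseteq> B" "orthonormal_basis B"
    using assms(1) orthonormal_basis_extend by meson
  have ortho: "orthonormal B"
    using B(2) by (auto simp: orthonormal_basis_def orthonormal_def)
  have coord: "e = sgn x \<or> cinner e x = 0" if "e \<in> B" "sgn x \<in> insert 0 B" for e x
  proof (cases "x = 0")
    case False
    then have "sgn x \<in> B" using that(2) by (simp add: sgn_zero_iff)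
    then have "e = sgn x \<or> cinner e (sgn x) = 0"
      using ortho that(1) by (auto simp: orthonormal_def)
    moreover have "cinner e x = norm x * cinner e (sgn x)"
      using False by (simp add: sgn_div_norm cinner_scaleR_right)
    ultimately show ?thesis by auto
  qed simp
  have ain: "sgn a \<in> insert 0 B" and bin: "sgn b \<in> insert 0 B" using B(1) by auto
  have couter: "couter x x e = of_real ((cmod (cinner e x))\<^sup>2) *\<^sub>C e"
    if e: "e \<in> B" and "sgn x \<in> insert 0 B" for e x
  proof (cases "cinner e x = 0")
    case False
    then have ex: "e = sgn x" and x0: "x \<noteq> 0" using coord[OF that] by auto
    have "cinner e x = of_real (norm x)"
      using x0 by (simp add: ex sgn_div_norm cinner_scaleR_left cinner_self power2_eq_square)
    moreover have "x = norm x *\<^sub>R e"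
      using x0 by (simp add: ex sgn_div_norm)
    ultimately show ?thesis
      by (metis couter_def norm_of_real abs_norm_cancel scaleC_of_real scaleR_scaleR power2_eq_square)
  qed (simp add: couter_def)
  define l where "l e = r * ((cmod (cinner e a))\<^sup>2 - (cmod (cinner e b))\<^sup>2)" for e
  have diag: "T e = of_real (l e) *\<^sub>C e" if "e \<in> B" for e
    unfolding T_eq couter[OF that ain] couter[OF that bin] l_def scaleC_of_real
    by (simp add: algebra_simps)
  have abs_l: "\<bar>l e\<bar> = \<bar>r\<bar> * ((cmod (cinner e a))\<^sup>2 + (cmod (cinner e b))\<^sup>2)" if "e \<in> B" for e
  proof -
    have "cinner e a = 0 \<or> cinner e b = 0"
    proof (rule ccontr)
      assume *: "\<not> ?thesis"
      then have "sgn a = sgn b" "a \<noteq> 0" using coord[OF that ain] coord[OF that bin] by auto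
      moreover have "cinner (sgn a) (sgn b) = 0"
        by (simp add: sgn_div_norm cinner_scaleR_left cinner_scaleR_right ab)
      ultimately show False using self[of a] by simp
    qed
    then show ?thesis by (auto simp: l_def abs_mult)
  qed
  have "nuclear_norm T = (\<Sum>e\<in>B. \<bar>l e\<bar>)"
    by (rule nuclear_norm_diagonal[OF B(2) T diag])
  also have "\<dots> = \<bar>r\<bar> * ((\<Sum>e\<in>B. (cmod (cinner e a))\<^sup>2) + (\<Sum>e\<in>B. (cmod (cinner e b))\<^sup>2))"
    by (simp add: abs_l sum_distrib_left sum.distrib[symmetric])
  finally show ?thesis
    by (simp only: parseval_norm[OF B(2)])
qed

text \<open>The added terms \<open>u(t\<i>u)\<^sup>*\<close> and \<open>(t\<i>u)u\<^sup>*\<close> are \<open>-t\<i>\<close> and \<open>t\<i>\<close> times \<open>uu\<^sup>*\<close>, and cancel.\<close>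
lemma sym_couter_imag_component: "sym_couter u (t *\<^sub>R (\<i> *\<^sub>C u) + w) = sym_couter u w"
proof
  fix x
  have "couter u (t *\<^sub>R (\<i> *\<^sub>C u) + w) x = - (cinner x u * (of_real t * \<i>)) *\<^sub>C u + couter u w x"
    by (simp add: couter_def cinner_add_right cinner_scaleR_right cinner_scaleC_right
        complex_vector.scale_left_distrib algebra_simps)
  moreover have "couter (t *\<^sub>R (\<i> *\<^sub>C u) + w) u x = (cinner x u * (of_real t * \<i>)) *\<^sub>C u + couter w u x"
    by (simp add: couter_def scaleC_of_real[symmetric] complex_vector.scale_right_distrib)
  ultimately show "sym_couter u (t *\<^sub>R (\<i> *\<^sub>C u) + w) x = sym_couter u w x"
    by (simp add: sym_couter_def)
qed

lemma sym_couter_polarisation: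
  "sym_couter u v x = (1/4) *\<^sub>R (couter (u + v) (u + v) x - couter (u - v) (u - v) x)"
  by (rule cinner_cancel_right)
    (simp add: sym_couter_def couter_def cinner_add_right cinner_diff_right cinner_scaleC_right
      cinner_scaleR_right field_simps)

lemma sym_couter_rescale:
  assumes "r \<noteq> 0"
  shows "sym_couter (r *\<^sub>R u) (inverse r *\<^sub>R v) = sym_couter u v"
  using assms
  by (auto simp: sym_couter_def couter_def fun_eq_iff scaleC_of_real[symmetric]
      cinner_scaleC_right field_simps)

text \<open>Replace \<open>v\<close> by its part \<open>w\<close> with \<open>\<langle>u, w\<rangle>\<close> real, and balance the lengths of \<open>u\<close> and \<open>w\<close>. Then the sum and the
difference are orthogonal, and polarisation writes the operator in the form treated above; its
nuclear norm is \<open>\<parallel>u\<parallel> \<parallel>w\<parallel>\<close>.\<close>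
lemma nuclear_norm_sym_couter:
  fixes u v :: "'a::complex_inner"
  assumes fin: "\<exists>S :: 'a set. finite S \<and> cspan S = UNIV"
  shows "(nuclear_norm (sym_couter u v))\<^sup>2 = phase_gap u v"
proof (cases "u = 0")
  case True
  then have "nuclear_norm (sym_couter u v) = 0"
    using nuclear_norm_orthogonal_difference[OF fin, of 0 0 "sym_couter u v" 0]
      selfadjoint_sym_couter[of u v]
    by (simp add: sym_couter_def couter_def)
  with True show ?thesis by (simp add: phase_gap_def)
next
  case False
  obtain t w where v: "v = t *\<^sub>R (\<i> *\<^sub>C u) + w" and w: "Im (cinner u w) = 0"
    using imag_component[OF False] .
  have "nuclear_norm (sym_couter u w) = norm u * norm w"
  proof (cases "w = 0")
    case True
    then have "nuclear_norm (sym_couter u w) = 0"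
      using nuclear_norm_orthogonal_difference[OF fin, of 0 0 "sym_couter u w" 0]
        selfadjoint_sym_couter[of u w]
      by (simp add: sym_couter_def couter_def)
    with True show ?thesis by simp
  next
    case w0: False
    \<comment> \<open>The factor that makes \<open>r u\<close> and \<open>r\<inverse> w\<close> equally long.\<close>
    define r where "r = sqrt (norm w / norm u)"
    have r: "r > 0" "r\<^sup>2 = norm w / norm u"
      using False w0 by (simp_all add: r_def)
    define u' w' where "u' = r *\<^sub>R u" and "w' = inverse r *\<^sub>R w"
    have nu: "(norm u')\<^sup>2 = norm u * norm w" and nw: "(norm w')\<^sup>2 = norm u * norm w"
      using False w0 r by (simp_all add: u'_def w'_def power_mult_distrib power_inverse
          power2_eq_square[of "norm _"])
    have im: "Im (cinner u' w') = 0"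
      using w by (simp add: u'_def w'_def cinner_scaleR_left cinner_scaleR_right)
    then have comm: "cinner w' u' = cinner u' w'"
      using cinner_commute[of w' u'] by (simp add: complex_eq_iff)
    define a b where "a = u' + w'" and "b = u' - w'"
    have "cinner a b = 0"
      by (simp add: a_def b_def cinner_add_left cinner_diff_right comm cinner_self nu nw
          del: of_real_power)
    moreover have "sym_couter u w x = (1/4) *\<^sub>R (couter a a x - couter b b x)" for x
      using sym_couter_rescale[of r u w] r sym_couter_polarisation[of u' w' x]
      by (simp add: a_def b_def u'_def w'_def)
    ultimately have "nuclear_norm (sym_couter u w) = \<bar>1/4\<bar> * ((norm a)\<^sup>2 + (norm b)\<^sup>2)"
      by (intro nuclear_norm_orthogonal_difference[OF fin] selfadjoint_sym_couter)
    also have "(norm a)\<^sup>2 + (norm b)\<^sup>2 = 2 * ((norm u')\<^sup>2 + (norm w')\<^sup>2)"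
      by (simp add: a_def b_def power2_norm_eq_inner inner_simps inner_commute)
    finally show ?thesis by (simp add: nu nw)
  qed
  then show ?thesis
    by (simp add: v sym_couter_imag_component phase_gap_imag_component[OF w] power_mult_distrib)
qed

section \<open>Realification\<close>

lemma linear_jmap:
  assumes "conjugation c"
  shows "linear (jmap c)"
proof (rule linearI)
  have scale: "c (r *\<^sub>R x) = r *\<^sub>R c x" for r x
    using assms by (metis conjugation_def scaleC_of_real complex_cnj_complex_of_real)
  show "jmap c (r *\<^sub>R x) = r *\<^sub>R jmap c x" for r x
    by (simp add: jmap_def scale scaleC_scaleR_commute flip: scaleR_add_right scaleR_diff_right)
  show "jmap c (x + y) = jmap c x + jmap c y" for x y
    using assms
    by (simp add: conjugation_def jmap_def complex_vector.scale_right_distrib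
        complex_vector.scale_right_diff_distrib)
qed

lemma norm_jmap:
  assumes "conjugation c"
  shows "norm (jmap c v) = norm v"
  by (simp add: norm_eq_sqrt_inner inner_jmap[OF assms] Re_cinner)

text \<open>\<open>J\<close> is multiplication by \<open>\<i>\<close>, which is skew-adjoint for the real inner product.\<close>
lemma adjoint_on_Jmap:
  assumes c: "conjugation c"
  shows "adjoint_on (HR c) Jmap (jmap c v) = jmap c (- \<i> *\<^sub>C v)"
  unfolding adjoint_on_def
proof (rule the_equality)
  have adj: "Jmap x \<bullet> jmap c v = x \<bullet> jmap c (- \<i> *\<^sub>C v)" if "x \<in> HR c" for x
    using that
    by (auto simp: HR_def Jmap_jmap[OF c] inner_jmap[OF c] cinner_scaleC_left cinner_scaleC_right
        simp del: complex_vector.scale_minus_left)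
  then show "jmap c (- \<i> *\<^sub>C v) \<in> HR c \<and> (\<forall>x\<in>HR c. Jmap x \<bullet> jmap c v = x \<bullet> jmap c (- \<i> *\<^sub>C v))"
    by (auto simp: HR_def)
  fix z assume z: "z \<in> HR c \<and> (\<forall>x\<in>HR c. Jmap x \<bullet> jmap c v = x \<bullet> z)"
  define d where "d = z - jmap c (- \<i> *\<^sub>C v)"
  have "d \<in> HR c"
    unfolding d_def using z subspace_HR[OF c] by (auto simp: HR_def intro!: subspace_diff)
  then have "d \<bullet> d = 0"
    using z adj by (simp add: d_def inner_diff_right)
  then show "z = jmap c (- \<i> *\<^sub>C v)" by (simp add: d_def)
qed

lemma Jouter_jmap:
  assumes c: "conjugation c"
  shows "Jouter c (jmap c u) (jmap c v) = Im (cinner v u) *\<^sub>R jmap c (\<i> *\<^sub>C u)"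
proof -
  have "Jmap (r *\<^sub>R p) = r *\<^sub>R Jmap p" for r and p :: "'a \<times> 'a"
    by (cases p) (simp add: Jmap_def)
  then show ?thesis
    by (simp add: Jouter_def router_def adjoint_on_Jmap[OF c] Jmap_jmap[OF c] inner_jmap[OF c]
        cinner_scaleC_left del: complex_vector.scale_minus_left)
qed

text \<open>\<open>\<Phi>\<^sub>k\<close> is the realification of \<open>f\<^sub>kf\<^sub>k\<^sup>*\<close>: its two summands carry the real and the imaginary part of the
coefficient \<open>\<langle>v, f\<^sub>k\<rangle>\<close>.\<close>
lemma Phi_jmap:
  assumes c: "conjugation c"
  shows "Phi c f k (jmap c v) = jmap c (cinner v (f k) *\<^sub>C f k)"
proof -
  interpret j: linear "jmap c" by (rule linear_jmap[OF c])
  have "cinner v (f k) *\<^sub>C f k =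
      (of_real (Re (cinner v (f k))) + of_real (Im (cinner v (f k))) * \<i>) *\<^sub>C f k"
    by (simp add: complex_eq mult.commute)
  also have "\<dots> = Re (cinner v (f k)) *\<^sub>R f k + Im (cinner v (f k)) *\<^sub>R (\<i> *\<^sub>C f k)"
    by (simp add: complex_vector.scale_left_distrib flip: scaleC_of_real)
  finally show ?thesis
    by (simp add: Phi_def router_def Jouter_jmap[OF c] inner_jmap[OF c] j.add j.scaleR)
qed

lemma Rop_jmap:
  assumes c: "conjugation c"
  shows "Rop c f m (jmap c u) (jmap c v) =
    (\<Sum>k=1..m. Re (cinner u (f k) * cinner (f k) v) *\<^sub>R jmap c (cinner u (f k) *\<^sub>C f k))"
  unfolding Rop_def
proof (rule sum.cong[OF refl])
  interpret j: linear "jmap c" by (rule linear_jmap[OF c])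
  fix k
  have "router (jmap c u) (Phi c f k (jmap c v)) =
      jmap c (Re (cinner u (f k) * cinner (f k) v) *\<^sub>R u)"
    unfolding Phi_jmap[OF c] router_def inner_jmap[OF c] cinner_scaleC_left Re_cinner_product_commute
    by (simp only: j.scaleR)
  then show "Phi c f k (router (jmap c u) (Phi c f k (jmap c v))) =
      Re (cinner u (f k) * cinner (f k) v) *\<^sub>R jmap c (cinner u (f k) *\<^sub>C f k)"
    by (simp only: Phi_jmap[OF c] cinner_scaleR_left j.scaleR[symmetric])
      (simp add: scaleC_of_real[symmetric])
qed

lemma Rop_quadratic_form:
  assumes c: "conjugation c"
  shows "Rop c f m (jmap c u) (jmap c v) \<bullet> jmap c v = frame_form f m u v"
  unfolding Rop_jmap[OF c] inner_sum_left inner_scaleR_left inner_jmap[OF c] cinner_scaleC_left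
    frame_form_def power2_eq_square ..

lemma Pperp_quadratic_form:
  assumes c: "conjugation c" and "u \<noteq> 0"
  shows "(norm (jmap c u))\<^sup>2 * (Pperp c (jmap c u) (jmap c v) \<bullet> jmap c v) = phase_gap u v"
proof -
  have "Im (cinner v u) = - Im (cinner u v)"
    by (subst cinner_commute) simp
  then have "Pperp c (jmap c u) (jmap c v) \<bullet> jmap c v =
      (norm v)\<^sup>2 - (Im (cinner u v))\<^sup>2 / (norm u)\<^sup>2"
    by (simp add: Pperp_def Jouter_jmap[OF c] norm_jmap[OF c] inner_diff_left inner_add_left inner_jmap[OF c]
        Re_scaleC_i Re_cinner_self power2_eq_square)
  then show ?thesis
    using assms(2) by (simp add: norm_jmap[OF c] phase_gap_def field_simps)
qed

text \<open>Viewed on \<open>'a\<close> through \<open>j\<close>, the operator \<open>R(j(u))\<close> is a real-linear map whose kernel is the zero set of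
\<open>frame_form f m u\<close>, since its quadratic form is a sum of squares of the coefficients in \<open>Rop_jmap\<close>.
This kernel contains \<open>\<i>u\<close>, so its dimension is 1 exactly if it is the line through \<open>\<i>u\<close>, which is the
zero set of \<open>phase_gap u\<close>. Since the dimension is at least 1, the truncated subtraction
\<open>2n - 1\<close> is harmless.\<close>
lemma dim_Rop_image:
  fixes f :: "nat \<Rightarrow> 'a::complex_inner"
  assumes c: "conjugation c" and B: "orthonormal_basis (B :: 'a set)" and u: "u \<noteq> 0"
  shows "dim (Rop c f m (jmap c u) ` HR c) = 2 * cdim (UNIV :: 'a set) - 1 \<longleftrightarrow>
    (\<forall>v. frame_form f m u v = 0 \<longrightarrow> phase_gap u v = 0)"
proof -
  define T where "T v = Rop c f m (jmap c u) (jmap c v)" for v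
  define K where "K = {v. T v = 0}"
  have "linear T"
  proof (rule linearI)
    have "Re (cinner u g * cinner g (x + y)) = Re (cinner u g * cinner g x) + Re (cinner u g * cinner g y)"
      for g x y
      by (simp only: cinner_add_right distrib_left plus_complex.sel)
    then show "T (x + y) = T x + T y" for x y
      unfolding T_def Rop_jmap[OF c] by (simp only: scaleR_add_left sum.distrib)
    have "Re (cinner u g * cinner g (r *\<^sub>R x)) = r * Re (cinner u g * cinner g x)" for g r x
      by (simp add: cinner_scaleR_right algebra_simps)
    then show "T (r *\<^sub>R x) = r *\<^sub>R T x" for r x
      unfolding T_def Rop_jmap[OF c] by (simp only: scaleR_sum_right scaleR_scaleR)
  qed
  moreover have fin: "finite (B \<union> (*\<^sub>C) \<i> ` B)"
    using B by (auto simp: orthonormal_basis_def)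
  ultimately have rank: "dim K + dim (range T) = 2 * cdim (UNIV :: 'a set)"
    unfolding K_def using rank_nullity real_basis[OF B] by metis
  have K: "v \<in> K \<longleftrightarrow> frame_form f m u v = 0" for v
  proof
    assume "v \<in> K"
    then show "frame_form f m u v = 0"
      using Rop_quadratic_form[OF c, of f m u v] by (simp add: K_def T_def)
  next
    assume "frame_form f m u v = 0"
    then show "v \<in> K"
      unfolding frame_form_eq_0_iff by (simp add: K_def T_def Rop_jmap[OF c])
  qed
  have iu: "\<i> *\<^sub>C u \<in> K" "\<i> *\<^sub>C u \<noteq> 0"
    using u frame_form_imag_component[of f m u 1 0] by (simp_all add: K frame_form_def)
  have Ksp: "K \<subseteq> span (B \<union> (*\<^sub>C) \<i> ` B)"
    using real_basis(1)[OF B] by simp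
  note dimK = subset_span_singleton_of_dim_1[OF fin Ksp iu]
  have "range T = Rop c f m (jmap c u) ` HR c"
    by (auto simp: T_def HR_def)
  then have "dim (Rop c f m (jmap c u) ` HR c) = 2 * cdim (UNIV :: 'a set) - 1 \<longleftrightarrow> dim K = 1"
    using rank dimK(1) by auto
  also have "\<dots> \<longleftrightarrow> K \<subseteq> span {\<i> *\<^sub>C u}"
  proof
    assume "K \<subseteq> span {\<i> *\<^sub>C u}"
    then show "dim K = 1"
      using iu by (intro dim_unique[of "{\<i> *\<^sub>C u}"]) auto
  qed (rule dimK(2))
  also have "\<dots> \<longleftrightarrow> (\<forall>v. frame_form f m u v = 0 \<longrightarrow> phase_gap u v = 0)"
    unfolding phase_gap_eq_0_iff[OF u] real_vector.span_singleton using K by blast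
  finally show ?thesis .
qed

section \<open>Equivalence of the conditions\<close>

theorem theorem3p1:
  fixes c :: "'a::complex_inner \<Rightarrow> 'a"
    and f :: "nat \<Rightarrow> 'a"
    and m n :: nat
  assumes "cdim (UNIV :: 'a set) = n"
    and "conjugation c"
    and "cspan (f ` {1..m}) = UNIV"
  shows
    "(inj_on (alpha f m) Hhat \<longleftrightarrow>
        (\<exists>a\<^sub>0>0. \<forall>u v.
          (\<Sum>k=1..m. (cmod (op_inner (couter (f k) (f k)) (sym_couter u v)))\<^sup>2)
            \<ge> a\<^sub>0 * (nuclear_norm (sym_couter u v))\<^sup>2)) \<and>
     (\<forall>a\<^sub>0>0.
        (\<forall>u v.
          (\<Sum>k=1..m. (cmod (op_inner (couter (f k) (f k)) (sym_couter u v)))\<^sup>2)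
            \<ge> a\<^sub>0 * (nuclear_norm (sym_couter u v))\<^sup>2) \<longleftrightarrow>
        (\<forall>u v.
          (\<Sum>k=1..m. (Re (cinner u (f k) * cinner (f k) v))\<^sup>2)
            \<ge> a\<^sub>0 * ((norm u)\<^sup>2 * (norm v)\<^sup>2 - (Im (cinner u v))\<^sup>2))) \<and>
     (inj_on (alpha f m) Hhat \<longleftrightarrow>
        (\<forall>\<xi>\<in>HR c. \<xi> \<noteq> 0 \<longrightarrow> dim (Rop c f m \<xi> ` HR c) = 2 * n - 1)) \<and>
     (inj_on (alpha f m) Hhat \<longleftrightarrow>
        (\<exists>a\<^sub>0>0. \<forall>\<xi>\<in>HR c. \<xi> \<noteq> 0 \<longrightarrow>
          (\<forall>\<eta>\<in>HR c. Rop c f m \<xi> \<eta> \<bullet> \<eta> \<ge> a\<^sub>0 * (norm \<xi>)\<^sup>2 * (Pperp c \<xi> \<eta> \<bullet> \<eta>))))"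
proof -
  note c = assms(2)
  have fin: "\<exists>S :: 'a set. finite S \<and> cspan S = UNIV"
    using assms(3) by blast
  have "orthonormal ({} :: 'a set)" by (simp add: orthonormal_def)
  then obtain B :: "'a set" where B: "orthonormal_basis B"
    using fin orthonormal_basis_extend by meson
  have lhs: "(\<Sum>k=1..m. (cmod (op_inner (couter (f k) (f k)) (sym_couter u v)))\<^sup>2) = frame_form f m u v"
    for u v
    unfolding frame_form_def cmod_op_inner_sym_couter[OF exI, OF B] ..
  have nz: "jmap c u \<noteq> 0 \<longleftrightarrow> u \<noteq> 0" for u
    using norm_jmap[OF c, of u] by (metis norm_eq_zero)
  have zero: "phase_gap 0 v = 0" "frame_form f m 0 v = 0" for v
    by (simp_all add: phase_gap_def frame_form_def)
  have rank: "(\<forall>\<xi>\<in>HR c. \<xi> \<noteq> 0 \<longrightarrow> dim (Rop c f m \<xi> ` HR c) = 2 * n - 1) \<longleftrightarrow>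
      (\<forall>u v. frame_form f m u v = 0 \<longrightarrow> phase_gap u v = 0)" (is "?L \<longleftrightarrow> ?R")
  proof -
    have "?L \<longleftrightarrow> (\<forall>u. u \<noteq> 0 \<longrightarrow> dim (Rop c f m (jmap c u) ` HR c) = 2 * n - 1)"
      by (simp add: HR_def nz)
    also have "\<dots> \<longleftrightarrow> (\<forall>u. u \<noteq> 0 \<longrightarrow> (\<forall>v. frame_form f m u v = 0 \<longrightarrow> phase_gap u v = 0))"
      using dim_Rop_image[OF c B] assms(1) by blast
    also have "\<dots> \<longleftrightarrow> ?R"
      using zero by metis
    finally show ?thesis .
  qed
  have quad: "(\<forall>\<xi>\<in>HR c. \<xi> \<noteq> 0 \<longrightarrow>
          (\<forall>\<eta>\<in>HR c. Rop c f m \<xi> \<eta> \<bullet> \<eta> \<ge> a * (norm \<xi>)\<^sup>2 * (Pperp c \<xi> \<eta> \<bullet> \<eta>))) \<longleftrightarrow>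
      (\<forall>u v. a * phase_gap u v \<le> frame_form f m u v)" (is "?L \<longleftrightarrow> ?R") for a
  proof -
    have "?L \<longleftrightarrow> (\<forall>u. u \<noteq> 0 \<longrightarrow> (\<forall>v. a * phase_gap u v \<le> frame_form f m u v))"
      by (simp add: HR_def nz Rop_quadratic_form[OF c] mult.assoc Pperp_quadratic_form[OF c])
    also have "\<dots> \<longleftrightarrow> ?R"
      using zero by (metis mult_zero_right order_refl)
    finally show ?thesis .
  qed
  show ?thesis
    unfolding lhs nuclear_norm_sym_couter[OF fin] rank quad
      frame_form_def[symmetric] phase_gap_def[symmetric]
    using definite_iff_lower_bound[OF B, of f m] by (simp add: inj_alpha_iff)
qed

end
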